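(* Let the discount function $\gamma$ satisfy: (a) $\gamma_t>0$ for all $t$; (b) $\gamma_t$ is monotone decreasing in $t$; (c) $H_t(\varepsilon)\in o(t)$ for all $\varepsilon>0$. Let $\mu$ be an environment satisfying the recoverability assumption $$\sup_{\pi'}\Big|\mathbb{E}^{\pi^*_\mu}_\mu[V^*_\mu(\ae_{<t})]-\mathbb{E}^{\pi'}_\mu[V^*_\mu(\ae_{<t})]\Big|\to0\quad\text{as }t\to\infty,$$ where the supremum is over all policies. Let $\pi$ be a policy that is asymptotically optimal in mean in the class $\{\mu\}$, i.e. $\mathbb{E}^\pi_\mu[V^*_\mu(\ae_{<t})-V^\pi_\mu(\ae_{<t})]\to0$ as $t\to\infty$. Then the regret satisfies $R_m(\pi,\mu)\in o(m)$.
   Context: The action set $\mathcal{A}$ and percept set $\mathcal{E}$ are finite; a percept is $e=(o,r)$ with reward $r\in[0,1]$. A history is $\ae_{<t}=a_1e_1\ldots a_{t-1}e_{t-1}\in(\mathcal{A}\times\mathcal{E})^*$. A policy $\pi$ maps each history to a distribution on $\mathcal{A}$; an environment $\mu$ maps each history and action to a distribution on $\mathcal{E}$. Together they induce the history distribution $\mu^\pi(\ae_{<t})=\prod_{k<t}\pi(a_k\mid\ae_{<k})\mu(e_k\mid\ae_{<k}a_k)$, with expectation $\mathbb{E}^\pi_\mu$. The discount function $\gamma:\mathbb{N}\to\mathbb{R}_{\ge0}$ is computable and summable, $\Gamma_t:=\sum_{k\ge t}\gamma_k$, and $H_t(\varepsilon):=\min\{k:\Gamma_{t+k}/\Gamma_t\le\varepsilon\}$.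 The value is $V^\pi_\mu(\ae_{<t}):=\frac1{\Gamma_t}\mathbb{E}^\pi_\mu[\sum_{k\ge t}\gamma_kr_k\mid\ae_{<t}]$, $V^*_\mu:=\sup_\pi V^\pi_\mu$, and $\pi^*_\mu$ denotes a $\mu$-optimal policy (attaining $V^*_\mu$ at all histories). The regret of $\pi$ in $\mu$ is the undiscounted quantity $R_m(\pi,\mu):=\sup_{\pi'}\mathbb{E}^{\pi'}_\mu\big[\sum_{t=1}^mr_t\big]-\mathbb{E}^\pi_\mu\big[\sum_{t=1}^mr_t\big]$. *)

theory Defs
  imports "HOL-Probability.Probability" "HOL-Library.Landau_Symbols"
begin

section \<open>Computable discount functions\<close>

text \<open>
  The total recursive functions of a fixed arity: \<open>total_recursive n f\<close> constrains \<open>f\<close> only on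
  argument lists of length \<open>n\<close>. Minimisation is restricted to regular functions; this closure
  yields exactly the total computable functions.
\<close>

inductive total_recursive :: "nat \<Rightarrow> (nat list \<Rightarrow> nat) \<Rightarrow> bool" where
  zero: "total_recursive n (\<lambda>_. 0)"
| succ: "total_recursive 1 (\<lambda>xs. Suc (hd xs))"
| proj: "i < n \<Longrightarrow> total_recursive n (\<lambda>xs. xs ! i)"
| comp: "total_recursive (length gs) f \<Longrightarrow> (\<forall>g\<in>set gs. total_recursive n g) \<Longrightarrow>
           total_recursive n (\<lambda>xs. f (map (\<lambda>g. g xs) gs))"
| prec: "total_recursive n f \<Longrightarrow> total_recursive (Suc (Suc n)) g \<Longrightarrow>
           total_recursive (Suc n) (\<lambda>xs. rec_nat (f (tl xs)) (\<lambda>k y. g (k # y # tl xs)) (hd xs))"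
| minim: "total_recursive (Suc n) f \<Longrightarrow> (\<forall>xs. length xs = n \<longrightarrow> (\<exists>k. f (k # xs) = 0)) \<Longrightarrow>
           total_recursive n (\<lambda>xs. LEAST k. f (k # xs) = 0)"

text \<open>
  Time steps are numbered from 1, so the value of a discount function at 0 is never constrained
  (and never used). Computability of a nonnegative real-valued function: dyadic approximations of
  any prescribed accuracy are produced by a single recursive function.
\<close>

definition computable_discount :: "(nat \<Rightarrow> real) \<Rightarrow> bool" where
  "computable_discount \<gamma> \<longleftrightarrow>
     (\<exists>f. total_recursive 2 f \<and> (\<forall>t\<ge>1. \<forall>k. \<bar>\<gamma> t - real (f [t, k]) / 2 ^ k\<bar> \<le> 1 / 2 ^ k))"

definition discount_function :: "(nat \<Rightarrow> real) \<Rightarrow> bool" where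
  "discount_function \<gamma> \<longleftrightarrow> (\<forall>t\<ge>1. 0 \<le> \<gamma> t) \<and> summable \<gamma> \<and> computable_discount \<gamma>"

definition discount_tail :: "(nat \<Rightarrow> real) \<Rightarrow> nat \<Rightarrow> real" where
  "discount_tail \<gamma> t = (\<Sum>k. \<gamma> (t + k))"

definition effective_horizon :: "(nat \<Rightarrow> real) \<Rightarrow> nat \<Rightarrow> real \<Rightarrow> nat" where
  "effective_horizon \<gamma> t \<epsilon> = (LEAST k. discount_tail \<gamma> (t + k) / discount_tail \<gamma> t \<le> \<epsilon>)"


section \<open>Policies, environments and the induced history distribution\<close>

text \<open>
  The finite action and percept sets are finite types \<open>'a\<close> and \<open>'e\<close>. A percept \<open>e = (o, r)\<close> is
  represented by an element of \<open>'e\<close> together with a function \<open>rew\<close> that reads off the reward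
  component \<open>r\<close>.
\<close>

type_synonym ('a, 'e) history = "('a \<times> 'e) list"
type_synonym ('a, 'e) policy = "('a, 'e) history \<Rightarrow> 'a pmf"
type_synonym ('a, 'e) environment = "('a, 'e) history \<Rightarrow> 'a \<Rightarrow> 'e pmf"

text \<open>
  An infinite trajectory is a function \<open>\<omega>\<close> on \<open>nat\<close>; the action and percept of time step \<open>t \<ge> 1\<close>
  are \<open>\<omega> (t - 1)\<close>.
\<close>

definition hist_before :: "nat \<Rightarrow> (nat \<Rightarrow> 'a \<times> 'e) \<Rightarrow> ('a, 'e) history" where
  "hist_before t \<omega> = map \<omega> [0..<t - 1]"

definition reward :: "('e \<Rightarrow> real) \<Rightarrow> nat \<Rightarrow> (nat \<Rightarrow> 'a \<times> 'e) \<Rightarrow> real" where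
  "reward rew t \<omega> = rew (snd (\<omega> (t - 1)))"

text \<open>
  Law of the step that follows history \<open>h'\<close>, when the initial segment \<open>h\<close> is prescribed: steps
  within \<open>h\<close> are replayed, afterwards \<open>\<pi>\<close> chooses the action and \<open>\<mu>\<close> the percept.
\<close>

definition next_step ::
    "('a, 'e) policy \<Rightarrow> ('a, 'e) environment \<Rightarrow> ('a, 'e) history \<Rightarrow> ('a, 'e) history \<Rightarrow> ('a \<times> 'e) pmf"
  where
  "next_step \<pi> \<mu> h h' =
     (if length h' < length h then return_pmf (h ! length h')
      else bind_pmf (\<pi> h') (\<lambda>a. map_pmf (\<lambda>e. (a, e)) (\<mu> h' a)))"

definition step_kernel ::
    "('a, 'e) policy \<Rightarrow> ('a, 'e) environment \<Rightarrow> ('a, 'e) history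
       \<Rightarrow> nat \<Rightarrow> (nat \<Rightarrow> 'a \<times> 'e) \<Rightarrow> ('a \<times> 'e) measure" where
  "step_kernel \<pi> \<mu> h i \<omega> = measure_pmf (next_step \<pi> \<mu> h (map \<omega> [0..<i]))"

text \<open>
  The Ionescu-Tulcea measure of the step kernels: the law of the infinite trajectory given that it
  starts with \<open>h\<close>. It is the conditional law given \<open>h\<close> whenever \<open>h\<close> has positive probability, and it
  is also defined for histories that \<open>\<pi>\<close> itself would never produce. For \<open>h = []\<close> it is the
  unconditional law.
\<close>

definition traj_measure ::
    "('a, 'e) policy \<Rightarrow> ('a, 'e) environment \<Rightarrow> ('a, 'e) history \<Rightarrow> (nat \<Rightarrow> 'a \<times> 'e) measure" where
  "traj_measure \<pi> \<mu> h =
     projective_family.lim UNIV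
       (Ionescu_Tulcea.CI (step_kernel \<pi> \<mu> h) (\<lambda>_. count_space UNIV)) (\<lambda>_. count_space UNIV)"

lemma Ionescu_Tulcea_step_kernel:
  fixes \<pi> :: "('a::finite, 'e::finite) policy"
  shows "Ionescu_Tulcea (step_kernel \<pi> \<mu> h) (\<lambda>_. count_space UNIV)"
proof (rule Ionescu_Tulcea.intro)
  fix i :: nat
  have "PiM {0..<i} (\<lambda>_. count_space (UNIV :: ('a \<times> 'e) set)) =
          count_space (PiE {0..<i} (\<lambda>_. UNIV))"
    by (rule count_space_PiM_finite) auto
  then show "step_kernel \<pi> \<mu> h i \<in>
      measurable (PiM {0..<i} (\<lambda>_. count_space UNIV)) (subprob_algebra (count_space UNIV))"
    by (simp add: step_kernel_def measure_pmf_in_subprob_algebra)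
next
  show "prob_space (step_kernel \<pi> \<mu> h i \<omega>)" for i \<omega>
    unfolding step_kernel_def by (rule prob_space_measure_pmf)
qed

lemma prob_space_traj_measure:
  fixes \<pi> :: "('a::finite, 'e::finite) policy"
  shows "prob_space (traj_measure \<pi> \<mu> h)"
proof -
  interpret IT: Ionescu_Tulcea "step_kernel \<pi> \<mu> h" "\<lambda>_. count_space UNIV"
    by (rule Ionescu_Tulcea_step_kernel)
  have "emeasure IT.PF.lim (prod_emb UNIV (\<lambda>_. count_space UNIV) {} {\<lambda>_. undefined}) =
          emeasure (IT.CI {}) {\<lambda>_. undefined}"
    by (rule IT.lim) (auto simp: PiM_empty)
  also have "\<dots> = 1"
    using prob_space.emeasure_space_1[OF IT.PF.prob_space_P[of "{}"]] IT.PF.space_P[of "{}"]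
    by (simp add: PiM_empty)
  also have "prod_emb UNIV (\<lambda>_. count_space UNIV) {} {\<lambda>_. undefined} = space IT.PF.lim"
    by (simp add: prod_emb_def space_PiM restrict_def)
  finally show ?thesis
    unfolding traj_measure_def by (rule prob_spaceI)
qed

lemma sets_traj_measure:
  fixes \<pi> :: "('a::finite, 'e::finite) policy"
  shows "sets (traj_measure \<pi> \<mu> h) = sets (PiM UNIV (\<lambda>_. count_space UNIV))"
proof -
  interpret IT: Ionescu_Tulcea "step_kernel \<pi> \<mu> h" "\<lambda>_. count_space UNIV"
    by (rule Ionescu_Tulcea_step_kernel)
  show ?thesis
    unfolding traj_measure_def by (rule IT.PF.sets_lim)
qed

text \<open>
  The probability of a finite history \<open>h'\<close>; for \<open>h = []\<close> the factors are
  \<open>\<pi>(a\<^sub>k | history) \<mu>(e\<^sub>k | history a\<^sub>k)\<close>.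
\<close>

lemma pmf_next_step:
  assumes "length h \<le> length h'"
  shows "pmf (next_step \<pi> \<mu> h h') (a, e) = pmf (\<pi> h') a * pmf (\<mu> h' a) e"
proof -
  have "pmf (map_pmf (Pair b) (\<mu> h' b)) (a, e) = pmf (\<mu> h' a) e * indicator {a} b" for b
  proof (cases "b = a")
    case True
    then show ?thesis by (simp add: pmf_map_inj' inj_on_def)
  next
    case False
    then show ?thesis by (auto simp: pmf_eq_0_set_pmf)
  qed
  then show ?thesis
    using assms by (simp add: next_step_def pmf_bind measure_pmf_single)
qed

lemma traj_measure_cylinder:
  fixes \<pi> :: "('a::finite, 'e::finite) policy"
  shows "measure (traj_measure \<pi> \<mu> h) {\<omega>. hist_before (Suc (length h')) \<omega> = h'} =
           (\<Prod>k<length h'. pmf (next_step \<pi> \<mu> h (take k h')) (h' ! k))"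
proof -
  interpret IT: Ionescu_Tulcea "step_kernel \<pi> \<mu> h" "\<lambda>_. count_space UNIV"
    by (rule Ionescu_Tulcea_step_kernel)
  let ?M = "\<lambda>_::nat. count_space (UNIV :: ('a \<times> 'e) set)"
  have PiM_eq: "PiM {0..<n} ?M = count_space (PiE {0..<n} (\<lambda>_. UNIV))" for n
    by (rule count_space_PiM_finite) auto
  define x where "x n = restrict (\<lambda>i. h' ! i) {0..<n}" for n
  have x_in: "x n \<in> PiE {0..<n} (\<lambda>_. UNIV)" for n
    by (simp add: x_def)
  have C: "emeasure (IT.C 0 n (\<lambda>_. undefined)) {x n} =
             (\<Prod>k<n. ennreal (pmf (next_step \<pi> \<mu> h (take k h')) (h' ! k)))"
    if "n \<le> length h'" for n
    using that
  proof (induction n)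
    case 0
    have "x 0 = (\<lambda>_. undefined)" by (simp add: x_def restrict_def)
    then show ?case by (simp add: PiM_empty)
  next
    case (Suc n)
    have undef: "(\<lambda>_. undefined) \<in> space (PiM {0..<0} ?M)" by (simp add: space_PiM)
    have xs: "{x (Suc n)} \<in> sets (PiM {0..<Suc n} ?M)"
      unfolding PiM_eq using x_in by simp
    have "emeasure (IT.C 0 (Suc n) (\<lambda>_. undefined)) {x (Suc n)} =
        (\<integral>\<^sup>+y. emeasure (IT.eP n y) {x (Suc n)} \<partial>IT.C 0 n (\<lambda>_. undefined))"
      using IT.measurable_eP[of n] IT.sets_C[OF undef, of n] IT.space_C[OF undef, of n] xs
      by (subst IT.C.simps, subst emeasure_bind[where N = "PiM {0..<Suc n} ?M"])
         (auto simp: space_PiM measurable_cong_sets[OF IT.sets_C[OF undef, of n] refl])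
    also have "\<dots> = (\<integral>\<^sup>+y. ennreal (pmf (next_step \<pi> \<mu> h (take n h')) (h' ! n)) *
                        indicator {x n} y \<partial>IT.C 0 n (\<lambda>_. undefined))"
    proof (rule nn_integral_cong)
      fix y assume "y \<in> space (IT.C 0 n (\<lambda>_. undefined))"
      then have y: "y \<in> space (PiM {0..<n} ?M)" using IT.space_C[OF undef, of n] by simp
      have vimage: "fun_upd y n -` {x (Suc n)} = (if y = x n then {h' ! n} else {})"
      proof -
        have "y(n := z) = x (Suc n) \<longleftrightarrow> y = x n \<and> z = h' ! n" for z
          using y
          by (auto simp: x_def space_PiM PiE_iff extensional_def fun_eq_iff restrict_def
              less_Suc_eq split: if_splits)
        then show ?thesis by auto
      qed
      have m: "map (x n) [0..<n] = take n h'"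
        using Suc.prems by (auto simp: x_def list_eq_iff_nth_eq)
      show "emeasure (IT.eP n y) {x (Suc n)} =
          ennreal (pmf (next_step \<pi> \<mu> h (take n h')) (h' ! n)) * indicator {x n} y"
        by (subst IT.emeasure_eP[OF y xs])
           (auto simp: vimage step_kernel_def m emeasure_pmf_single)
    qed
    also have "\<dots> = ennreal (pmf (next_step \<pi> \<mu> h (take n h')) (h' ! n)) *
                      emeasure (IT.C 0 n (\<lambda>_. undefined)) {x n}"
      using IT.sets_C[OF undef, of n] x_in
      by (subst nn_integral_cmult_indicator) (auto simp: PiM_eq)
    finally show ?case using Suc by (simp add: mult.commute)
  qed
  let ?n = "length h'"
  have "hist_before (Suc ?n) \<omega> = h' \<longleftrightarrow> restrict \<omega> {0..<?n} = x ?n" for \<omega>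
  proof -
    have "hist_before (Suc ?n) \<omega> = h' \<longleftrightarrow> (\<forall>i<?n. \<omega> i = h' ! i)"
      unfolding hist_before_def by (subst list_eq_iff_nth_eq) auto
    also have "\<dots> \<longleftrightarrow> restrict \<omega> {0..<?n} = x ?n"
      unfolding x_def restrict_def fun_eq_iff by auto
    finally show ?thesis .
  qed
  then have "{\<omega>. hist_before (Suc ?n) \<omega> = h'} = prod_emb UNIV ?M {0..<?n} {x ?n}"
    by (simp add: prod_emb_def vimage_def)
  moreover have "emeasure IT.PF.lim (prod_emb UNIV ?M {0..<?n} {x ?n}) =
      emeasure (IT.C 0 ?n (\<lambda>_. undefined)) {x ?n}"
  proof -
    have s: "{x ?n} \<in> sets (PiM {0..<?n} ?M)" unfolding PiM_eq using x_in by simp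
    have "emeasure IT.PF.lim (prod_emb UNIV ?M {0..<?n} {x ?n}) = emeasure (IT.CI {0..<?n}) {x ?n}"
      by (rule IT.lim) (use s in auto)
    also have "\<dots> = emeasure (IT.C 0 ?n (\<lambda>_. undefined))
                      (prod_emb {0..<?n} ?M {0..<?n} {x ?n})"
      by (rule IT.emeasure_CI) (use s in auto)
    also have "prod_emb {0..<?n} ?M {0..<?n} {x ?n} = {x ?n}"
      by (rule prod_emb_id) (use x_in in auto)
    finally show ?thesis .
  qed
  ultimately have "emeasure (traj_measure \<pi> \<mu> h) {\<omega>. hist_before (Suc ?n) \<omega> = h'} =
      (\<Prod>k<?n. ennreal (pmf (next_step \<pi> \<mu> h (take k h')) (h' ! k)))"
    using C[of ?n] by (simp add: traj_measure_def)
  then show ?thesis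
    by (simp add: measure_def prod_ennreal prod_nonneg)
qed


section \<open>Values, optimality and regret\<close>

definition policy_value ::
    "(nat \<Rightarrow> real) \<Rightarrow> ('e \<Rightarrow> real) \<Rightarrow> ('a, 'e) environment \<Rightarrow> ('a, 'e) policy \<Rightarrow> ('a, 'e) history \<Rightarrow> real"
  where
  "policy_value \<gamma> rew \<mu> \<pi> h =
     (let t = Suc (length h) in
        1 / discount_tail \<gamma> t *
          (\<integral>\<omega>. (\<Sum>k. \<gamma> (t + k) * reward rew (t + k) \<omega>) \<partial>traj_measure \<pi> \<mu> h))"

definition optimal_value ::
    "(nat \<Rightarrow> real) \<Rightarrow> ('e \<Rightarrow> real) \<Rightarrow> ('a, 'e) environment \<Rightarrow> ('a, 'e) history \<Rightarrow> real" where
  "optimal_value \<gamma> rew \<mu> h = (SUP \<pi>. policy_value \<gamma> rew \<mu> \<pi> h)"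

definition optimal_policy ::
    "(nat \<Rightarrow> real) \<Rightarrow> ('e \<Rightarrow> real) \<Rightarrow> ('a, 'e) environment \<Rightarrow> ('a, 'e) policy \<Rightarrow> bool" where
  "optimal_policy \<gamma> rew \<mu> \<pi> \<longleftrightarrow> (\<forall>h. policy_value \<gamma> rew \<mu> \<pi> h = optimal_value \<gamma> rew \<mu> h)"

definition expectation ::
    "('a, 'e) environment \<Rightarrow> ('a, 'e) policy \<Rightarrow> ((nat \<Rightarrow> 'a \<times> 'e) \<Rightarrow> real) \<Rightarrow> real" where
  "expectation \<mu> \<pi> X = (\<integral>\<omega>. X \<omega> \<partial>traj_measure \<pi> \<mu> [])"

definition recoverable ::
    "(nat \<Rightarrow> real) \<Rightarrow> ('e \<Rightarrow> real) \<Rightarrow> ('a, 'e) environment \<Rightarrow> ('a, 'e) policy \<Rightarrow> bool" where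
  "recoverable \<gamma> rew \<mu> \<pi>opt \<longleftrightarrow>
     (\<lambda>t. SUP \<pi>'. \<bar>expectation \<mu> \<pi>opt (\<lambda>\<omega>. optimal_value \<gamma> rew \<mu> (hist_before t \<omega>)) -
                   expectation \<mu> \<pi>' (\<lambda>\<omega>. optimal_value \<gamma> rew \<mu> (hist_before t \<omega>))\<bar>)
       \<longlonglongrightarrow> 0"

definition asymptotically_optimal_in_mean ::
    "(nat \<Rightarrow> real) \<Rightarrow> ('e \<Rightarrow> real) \<Rightarrow> ('a, 'e) environment set \<Rightarrow> ('a, 'e) policy \<Rightarrow> bool" where
  "asymptotically_optimal_in_mean \<gamma> rew \<M> \<pi> \<longleftrightarrow>
     (\<forall>\<mu>\<in>\<M>. (\<lambda>t. expectation \<mu> \<pi> (\<lambda>\<omega>. optimal_value \<gamma> rew \<mu> (hist_before t \<omega>) -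
                                      policy_value \<gamma> rew \<mu> \<pi> (hist_before t \<omega>))) \<longlonglongrightarrow> 0)"

definition regret ::
    "('e \<Rightarrow> real) \<Rightarrow> ('a, 'e) policy \<Rightarrow> ('a, 'e) environment \<Rightarrow> nat \<Rightarrow> real" where
  "regret rew \<pi> \<mu> m =
     (SUP \<pi>'. expectation \<mu> \<pi>' (\<lambda>\<omega>. \<Sum>t=1..m. reward rew t \<omega>)) -
     expectation \<mu> \<pi> (\<lambda>\<omega>. \<Sum>t=1..m. reward rew t \<omega>)"

end

theory Submission
  imports Defs
begin

text \<open>
  Recoverability and optimality in mean bound, uniformly in \<open>\<pi>'\<close>, the difference of the expected
  values at time \<open>t\<close> of \<open>\<pi>'\<close> and of \<open>\<pi>\<close>, each along its own histories, by some \<open>e t \<rightarrow> 0\<close>. By the tower property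
  this says that the discounted tail from \<open>t\<close> of the expected reward differences is at most
  \<open>e t \<cdot> \<Gamma> t\<close>. Summation by parts with the weights \<open>1 / \<gamma> t - 1 / \<gamma> (t - 1)\<close>, which are nonnegative
  because \<open>\<gamma>\<close> decreases, turns these tails into undiscounted partial sums up to a boundary term of
  size \<open>\<Gamma> m / \<gamma> m\<close>, and this is at most twice the horizon \<open>H m (1/2)\<close>, hence \<open>o(m)\<close>.
\<close>

section \<open>Integrals of functions of finite histories\<close>

lemma sets_hist_before:
  fixes \<pi> :: "('a::finite, 'e::finite) policy"
  shows "{\<omega>. hist_before (Suc n) \<omega> = h'} \<in> sets (traj_measure \<pi> \<mu> h)"
proof (cases "length h' = n")
  case True
  let ?P = "PiM UNIV (\<lambda>_::nat. count_space (UNIV :: ('a \<times> 'e) set))"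
  have "{\<omega>. hist_before (Suc n) \<omega> = h'} = {\<omega> \<in> space ?P. \<forall>i\<in>{..<n}. \<omega> i = h' ! i}"
    using True by (auto simp: hist_before_def list_eq_iff_nth_eq space_PiM)
  also have "\<dots> \<in> sets ?P"
    by measurable
  finally show ?thesis
    by (simp add: sets_traj_measure)
next
  case False
  then have "{\<omega>. hist_before (Suc n) \<omega> = h'} = {}"
    by (auto simp: hist_before_def)
  then show ?thesis
    by (metis sets.empty_sets)
qed

lemma finite_lists_length [simp]: "finite {xs :: 'a::finite list. length xs = n}"
  using finite_lists_length_eq[of "UNIV :: 'a set" n] by simp

text \<open>\<open>hist_before (Suc n)\<close> has exactly \<open>n\<close> steps and there are only
  finitely many such histories, so any function of it is a finite combination of indicators of
  cylinders, whose measures are given by \<open>traj_measure_cylinder\<close>. Integrability and the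
  value of the integral come out together, for arbitrary \<open>f\<close>.\<close>

lemma has_integral_hist_before:
  fixes \<pi> :: "('a::finite, 'e::finite) policy" and f :: "('a, 'e) history \<Rightarrow> real"
  shows "has_bochner_integral (traj_measure \<pi> \<mu> h) (\<lambda>\<omega>. f (hist_before (Suc n) \<omega>))
    (\<Sum>h' | length h' = n. f h' * (\<Prod>k<n. pmf (next_step \<pi> \<mu> h (take k h')) (h' ! k)))"
proof -
  interpret prob_space "traj_measure \<pi> \<mu> h"
    by (rule prob_space_traj_measure)
  have eq: "(\<lambda>\<omega>. f (hist_before (Suc n) \<omega>)) =
      (\<lambda>\<omega>. \<Sum>h' | length h' = n. f h' * indicator {\<omega>. hist_before (Suc n) \<omega> = h'} \<omega>)"
  proof
    fix \<omega> :: "nat \<Rightarrow> 'a \<times> 'e"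
    have "(\<Sum>h' | length h' = n. f h' * indicator {\<omega>. hist_before (Suc n) \<omega> = h'} \<omega>) =
        (\<Sum>h' | length h' = n. if hist_before (Suc n) \<omega> = h' then f h' else 0)"
      by (intro sum.cong) auto
    also have "\<dots> = f (hist_before (Suc n) \<omega>)"
      by (simp add: hist_before_def)
    finally show "f (hist_before (Suc n) \<omega>) =
        (\<Sum>h' | length h' = n. f h' * indicator {\<omega>. hist_before (Suc n) \<omega> = h'} \<omega>)"
      by (rule sym)
  qed
  have "has_bochner_integral (traj_measure \<pi> \<mu> h)
      (\<lambda>\<omega>. f h' * indicator {\<omega>. hist_before (Suc n) \<omega> = h'} \<omega>)
      (f h' * (\<Prod>k<n. pmf (next_step \<pi> \<mu> h (take k h')) (h' ! k)))" if "length h' = n" for h'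
  proof -
    have "has_bochner_integral (traj_measure \<pi> \<mu> h)
      (indicator {\<omega>. hist_before (Suc n) \<omega> = h'} :: _ \<Rightarrow> real)
      (measure (traj_measure \<pi> \<mu> h) {\<omega>. hist_before (Suc n) \<omega> = h'})"
      by (intro has_bochner_integral_real_indicator sets_hist_before) (auto simp: less_top[symmetric])
    then show ?thesis
      using traj_measure_cylinder[of \<pi> \<mu> h h'] that
      by (auto intro!: has_bochner_integral_mult_right)
  qed
  then show ?thesis
    unfolding eq by (intro has_bochner_integral_sum) auto
qed

lemma integrable_hist_before [simp, intro]:
  fixes \<pi> :: "('a::finite, 'e::finite) policy" and f :: "('a, 'e) history \<Rightarrow> real"
  shows "integrable (traj_measure \<pi> \<mu> h) (\<lambda>\<omega>. f (hist_before t \<omega>))"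
proof -
  \<comment> \<open>Truncated subtraction makes both \<open>hist_before 0\<close> and
    \<open>hist_before 1\<close> empty, so the equation also holds at \<open>t = 0\<close>.\<close>
  have "hist_before t = (hist_before (Suc (t - 1)) :: _ \<Rightarrow> ('a, 'e) history)"
    by (simp add: hist_before_def fun_eq_iff)
  then show ?thesis
    by (rule ssubst) (rule integrable.intros[OF has_integral_hist_before])
qed

lemma integral_hist_before_between:
  fixes \<pi> :: "('a::finite, 'e::finite) policy" and f :: "('a, 'e) history \<Rightarrow> real"
  assumes "\<And>h. a \<le> f h" "\<And>h. f h \<le> b"
  shows "(\<integral>\<omega>. f (hist_before t \<omega>) \<partial>traj_measure \<pi> \<mu> h) \<in> {a..b}"
proof -
  interpret prob_space "traj_measure \<pi> \<mu> h"
    by (rule prob_space_traj_measure)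
  show ?thesis
    using assms by (auto intro!: integral_ge_const integral_le_const)
qed

section \<open>The tower property for prescribed initial histories\<close>

text \<open>Replaying \<open>h\<close> uses point masses, so the first \<open>length h\<close>
  factors are 0 or 1 and multiply to the indicator that \<open>h'\<close> extends \<open>h\<close>.
  The later factors no longer see \<open>h\<close>, which may therefore be replaced by
  \<open>[]\<close>.\<close>

lemma prod_next_step_replay:
  assumes "length h \<le> m" "length h' = m"
  shows "(\<Prod>k<m. pmf (next_step \<pi> \<mu> h (take k h')) (h' ! k)) =
    (if take (length h) h' = h
     then \<Prod>k=length h..<m. pmf (next_step \<pi> \<mu> [] (take k h')) (h' ! k) else 0)"
proof -
  let ?n = "length h"
  let ?g = "\<lambda>k. pmf (next_step \<pi> \<mu> h (take k h')) (h' ! k)"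
  have split: "(\<Prod>k<m. ?g k) = (\<Prod>k<?n. ?g k) * (\<Prod>k=?n..<m. ?g k)"
    unfolding lessThan_atLeast0 using assms(1)
    by (intro prod.atLeastLessThan_concat[symmetric]) auto
  have 1: "(\<Prod>k=?n..<m. ?g k) = (\<Prod>k=?n..<m. pmf (next_step \<pi> \<mu> [] (take k h')) (h' ! k))"
    using assms by (intro prod.cong refl) (simp add: next_step_def)
  have 2: "(\<Prod>k<?n. ?g k) = (\<Prod>k<?n. of_bool (h ! k = h' ! k))"
    using assms by (intro prod.cong refl) (auto simp: next_step_def indicator_def)
  have 3: "take ?n h' = h \<longleftrightarrow> (\<forall>k<?n. h ! k = h' ! k)"
    using assms by (auto simp: list_eq_iff_nth_eq)
  have "(\<Prod>k<?n. of_bool (h ! k = h' ! k)) = (of_bool (take ?n h' = h) :: real)"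
    unfolding 3 by (induction ?n) (auto simp: less_Suc_eq)
  with split 1 2 show ?thesis
    by simp
qed

text \<open>With all integrals written as finite sums, the probability of a prefix times that of its
  continuation is the probability of the whole history. The laws with prescribed \<open>h\<close>
  thus act as conditional laws; a prefix of probability 0 enters with weight 0.\<close>

lemma integral_tower:
  fixes \<pi> :: "('a::finite, 'e::finite) policy" and f :: "('a, 'e) history \<Rightarrow> real"
  assumes "n \<le> m"
  shows "(\<integral>\<omega>. (\<integral>\<omega>'. f (hist_before (Suc m) \<omega>') \<partial>traj_measure \<pi> \<mu> (hist_before (Suc n) \<omega>))
            \<partial>traj_measure \<pi> \<mu> []) =
         (\<integral>\<omega>. f (hist_before (Suc m) \<omega>) \<partial>traj_measure \<pi> \<mu> [])"
proof -
  let ?p = "\<lambda>h k. pmf (next_step \<pi> \<mu> [] (take k h)) (h ! k)"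
  have int: "(\<integral>\<omega>. g (hist_before (Suc j) \<omega>) \<partial>traj_measure \<pi> \<mu> h) =
      (\<Sum>h' | length h' = j. g h' * (\<Prod>k<j. pmf (next_step \<pi> \<mu> h (take k h')) (h' ! k)))"
    for h j and g :: "('a, 'e) history \<Rightarrow> real"
    by (rule has_bochner_integral_integral_eq[OF has_integral_hist_before])
  have "(\<integral>\<omega>. (\<integral>\<omega>'. f (hist_before (Suc m) \<omega>') \<partial>traj_measure \<pi> \<mu> (hist_before (Suc n) \<omega>))
            \<partial>traj_measure \<pi> \<mu> []) =
      (\<Sum>h | length h = n. (\<Sum>h' | length h' = m.
         if take n h' = h then f h' * (\<Prod>k=n..<m. ?p h' k) else 0) * (\<Prod>k<n. ?p h k))"
  proof (subst int[where g = "\<lambda>h. \<integral>\<omega>'. f (hist_before (Suc m) \<omega>') \<partial>traj_measure \<pi> \<mu> h"],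
      intro sum.cong refl arg_cong2[where f = times])
    fix h :: "('a, 'e) history"
    assume "h \<in> {h. length h = n}"
    then show "(\<integral>\<omega>'. f (hist_before (Suc m) \<omega>') \<partial>traj_measure \<pi> \<mu> h) =
        (\<Sum>h' | length h' = m. if take n h' = h then f h' * (\<Prod>k=n..<m. ?p h' k) else 0)"
      using assms by (subst int, intro sum.cong) (auto simp: prod_next_step_replay)
  qed
  also have "\<dots> = (\<Sum>h' | length h' = m. \<Sum>h | length h = n.
      if take n h' = h then f h' * (\<Prod>k=n..<m. ?p h' k) * (\<Prod>k<n. ?p h k) else 0)"
    by (subst sum.swap) (auto simp: sum_distrib_right intro!: sum.cong)
  also have "\<dots> = (\<Sum>h' | length h' = m. f h' * (\<Prod>k<m. ?p h' k))"
  proof (intro sum.cong refl)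
    fix h' :: "('a, 'e) history"
    assume "h' \<in> {h'. length h' = m}"
    \<comment> \<open>Exactly one prefix, \<open>take n h'\<close>, contributes; it has length
      \<open>n\<close> because \<open>n \<le> m\<close>.\<close>
    then have "(\<Sum>h | length h = n.
        if take n h' = h then f h' * (\<Prod>k=n..<m. ?p h' k) * (\<Prod>k<n. ?p h k) else 0) =
      f h' * (\<Prod>k=n..<m. ?p h' k) * (\<Prod>k<n. ?p (take n h') k)"
      using assms by (simp add: min_def)
    also have "(\<Prod>k<n. ?p (take n h') k) = (\<Prod>k<n. ?p h' k)"
      by (intro prod.cong) (auto simp: min_def)
    also have "f h' * (\<Prod>k=n..<m. ?p h' k) * (\<Prod>k<n. ?p h' k) = f h' * (\<Prod>k<m. ?p h' k)"
      using assms prod.atLeastLessThan_concat[of 0 n m "?p h'"]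
      by (simp add: lessThan_atLeast0 mult_ac)
    finally show "(\<Sum>h | length h = n.
        if take n h' = h then f h' * (\<Prod>k=n..<m. ?p h' k) * (\<Prod>k<n. ?p h k) else 0) =
      f h' * (\<Prod>k<m. ?p h' k)" .
  qed
  also have "\<dots> = (\<integral>\<omega>. f (hist_before (Suc m) \<omega>) \<partial>traj_measure \<pi> \<mu> [])"
    by (rule int[symmetric])
  finally show ?thesis .
qed

section \<open>Expected rewards and values as discounted series\<close>

text \<open>This makes rewards functions of a finite history, so that the integrals above apply. At
  \<open>t = 0\<close> the history would be empty and its last element unspecified.\<close>

lemma reward_hist_before:
  assumes "t \<ge> 1"
  shows "reward rew t \<omega> = rew (snd (last (hist_before (Suc t) \<omega>)))"
  using assms by (simp add: reward_def hist_before_def last_map)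

lemma integrable_reward [simp]:
  fixes \<pi> :: "('a::finite, 'e::finite) policy"
  assumes "t \<ge> 1"
  shows "integrable (traj_measure \<pi> \<mu> h) (reward rew t)"
  using integrable_hist_before[of \<pi> \<mu> h "\<lambda>h. rew (snd (last h))" "Suc t"]
  by (simp add: reward_hist_before[OF assms, abs_def])

lemma integral_reward_between:
  fixes \<pi> :: "('a::finite, 'e::finite) policy"
  assumes "\<And>e. 0 \<le> rew e \<and> rew e \<le> 1" and "t \<ge> 1"
  shows "(\<integral>\<omega>. reward rew t \<omega> \<partial>traj_measure \<pi> \<mu> h) \<in> {0..1}"
  unfolding reward_hist_before[OF assms(2)]
  by (rule integral_hist_before_between[where f = "\<lambda>h. rew (snd (last h))"]) (use assms in auto)

lemma integral_reward_tower:
  fixes \<pi> :: "('a::finite, 'e::finite) policy"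
  assumes "t \<ge> 1" "t \<le> s"
  shows "expectation \<mu> \<pi> (\<lambda>\<omega>. \<integral>\<omega>'. reward rew s \<omega>' \<partial>traj_measure \<pi> \<mu> (hist_before t \<omega>)) =
    expectation \<mu> \<pi> (reward rew s)"
proof -
  \<comment> \<open>The history before time \<open>t\<close> has \<open>t - 1\<close> steps, while
    reward \<open>s\<close> is read off the first \<open>s\<close> steps.\<close>
  have "s \<ge> 1" "t - 1 \<le> s" "Suc (t - 1) = t"
    using assms by auto
  then show ?thesis
    unfolding expectation_def
    using integral_tower[of "t - 1" s \<pi> \<mu> "\<lambda>h. rew (snd (last h))"]
    by (simp add: reward_hist_before[OF \<open>s \<ge> 1\<close>, abs_def])
qed

text \<open>Sum and integral may be exchanged because rewards lie in [0,1]: both the pointwise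
  series and the series of integrated norms are dominated by the summable discounts.\<close>

lemma integral_discounted_reward:
  fixes \<pi> :: "('a::finite, 'e::finite) policy"
  assumes rew: "\<And>e. 0 \<le> rew e \<and> rew e \<le> 1"
    and \<gamma>: "summable \<gamma>" "\<And>t. t \<ge> 1 \<Longrightarrow> \<gamma> t > 0" and t: "t \<ge> 1"
  shows "(\<integral>\<omega>. (\<Sum>k. \<gamma> (t + k) * reward rew (t + k) \<omega>) \<partial>traj_measure \<pi> \<mu> h) =
    (\<Sum>k. \<gamma> (t + k) * (\<integral>\<omega>. reward rew (t + k) \<omega> \<partial>traj_measure \<pi> \<mu> h))"
proof -
  have s: "summable (\<lambda>k. \<gamma> (t + k))"
    using \<gamma>(1) by (simp add: summable_iff_shift add.commute[of t])
  have pos: "\<gamma> (t + k) > 0" for k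
    using \<gamma>(2) t by simp
  have r: "0 \<le> reward rew j \<omega>" "reward rew j \<omega> \<le> 1" for j and \<omega> :: "nat \<Rightarrow> 'a \<times> 'e"
    using rew by (auto simp: reward_def)
  have le: "norm (\<gamma> (t + k) * reward rew (t + k) \<omega>) \<le> \<gamma> (t + k)" for k and \<omega> :: "nat \<Rightarrow> 'a \<times> 'e"
    using r pos[of k] by (simp add: abs_mult mult_left_le)
  have sr: "summable (\<lambda>k. norm (\<gamma> (t + k) * reward rew (t + k) \<omega>))" for \<omega> :: "nat \<Rightarrow> 'a \<times> 'e"
    by (rule summable_comparison_test'[OF s, of 0]) (use le in simp)
  have nrm: "norm (\<gamma> (t + k) * reward rew (t + k) \<omega>) = \<gamma> (t + k) * reward rew (t + k) \<omega>"
    for k and \<omega> :: "nat \<Rightarrow> 'a \<times> 'e"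
    using r pos[of k] by (simp add: abs_mult)
  have si: "summable (\<lambda>k. \<integral>\<omega>. norm (\<gamma> (t + k) * reward rew (t + k) \<omega>) \<partial>traj_measure \<pi> \<mu> h)"
  proof (rule summable_comparison_test'[OF s, of 0])
    fix k
    show "norm (\<integral>\<omega>. norm (\<gamma> (t + k) * reward rew (t + k) \<omega>) \<partial>traj_measure \<pi> \<mu> h) \<le> \<gamma> (t + k)"
      using integral_reward_between[of rew "t + k" \<pi> \<mu> h, OF rew] t pos[of k]
      unfolding nrm by (simp add: abs_mult mult_left_le)
  qed
  have "(\<integral>\<omega>. (\<Sum>k. \<gamma> (t + k) * reward rew (t + k) \<omega>) \<partial>traj_measure \<pi> \<mu> h) =
      (\<Sum>k. \<integral>\<omega>. \<gamma> (t + k) * reward rew (t + k) \<omega> \<partial>traj_measure \<pi> \<mu> h)"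
    by (intro integral_suminf AE_I2 sr si integrable_mult_right integrable_reward) (use t in simp)
  then show ?thesis
    by simp
qed

text \<open>The sequence \<open>x\<close> will be expected rewards, differences of them, or the
  constant 1; the last case gives the shifted discounts themselves.\<close>

lemma summable_discounted:
  fixes \<gamma> x :: "nat \<Rightarrow> real"
  assumes "summable \<gamma>" "\<And>t. t \<ge> 1 \<Longrightarrow> \<gamma> t > 0" "\<And>t. t \<ge> 1 \<Longrightarrow> \<bar>x t\<bar> \<le> 1" "t \<ge> 1"
  shows "summable (\<lambda>k. \<gamma> (t + k) * x (t + k))"
proof (rule summable_comparison_test'[of "\<lambda>k. \<gamma> (t + k)" 0])
  show "summable (\<lambda>k. \<gamma> (t + k))"
    using assms(1) by (simp add: summable_iff_shift add.commute[of t])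
  show "norm (\<gamma> (t + k) * x (t + k)) \<le> \<gamma> (t + k)" for k
    using assms(2)[of "t + k"] assms(3)[of "t + k"] assms(4) by (simp add: abs_mult mult_left_le)
qed

lemma discount_tail_pos:
  assumes "summable \<gamma>" "\<And>t. t \<ge> 1 \<Longrightarrow> \<gamma> t > 0" "t \<ge> 1"
  shows "discount_tail \<gamma> t > 0"
  unfolding discount_tail_def
  using summable_discounted[OF assms(1,2), of "\<lambda>_. 1" t] assms by (auto intro!: suminf_pos)

text \<open>The time is a variable tied to \<open>h\<close> by an equation, so that one
  \<open>t\<close> serves all histories \<open>hist_before t \<omega>\<close> at once.\<close>

lemma policy_value_eq:
  fixes \<pi> :: "('a::finite, 'e::finite) policy"
  assumes "\<And>e. 0 \<le> rew e \<and> rew e \<le> 1" "summable \<gamma>" "\<And>t. t \<ge> 1 \<Longrightarrow> \<gamma> t > 0"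
    and "t = Suc (length h)"
  shows "policy_value \<gamma> rew \<mu> \<pi> h =
    (\<Sum>k. \<gamma> (t + k) * (\<integral>\<omega>. reward rew (t + k) \<omega> \<partial>traj_measure \<pi> \<mu> h)) / discount_tail \<gamma> t"
  using integral_discounted_reward[of rew \<gamma> t \<pi> \<mu> h] assms by (simp add: policy_value_def)

lemma policy_value_between:
  fixes \<pi> :: "('a::finite, 'e::finite) policy"
  assumes rew: "\<And>e. 0 \<le> rew e \<and> rew e \<le> 1" and \<gamma>: "summable \<gamma>" "\<And>t. t \<ge> 1 \<Longrightarrow> \<gamma> t > 0"
  shows "policy_value \<gamma> rew \<mu> \<pi> h \<in> {0..1}"
proof -
  define t where "t = Suc (length h)"
  let ?x = "\<lambda>s. \<integral>\<omega>. reward rew s \<omega> \<partial>traj_measure \<pi> \<mu> h"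
  have t: "t \<ge> 1" by (simp add: t_def)
  have x: "0 \<le> ?x s" "?x s \<le> 1" if "s \<ge> 1" for s
    using integral_reward_between[of rew s \<pi> \<mu> h, OF rew that] by auto
  have pos: "\<gamma> (t + k) > 0" for k
    using \<gamma>(2) t by simp
  have s: "summable (\<lambda>k. \<gamma> (t + k) * ?x (t + k))"
    by (rule summable_discounted) (use \<gamma> t x in auto)
  have s1: "summable (\<lambda>k. \<gamma> (t + k))"
    using summable_discounted[OF \<gamma>, of "\<lambda>_. 1" t] t by simp
  have "(\<Sum>k. \<gamma> (t + k) * ?x (t + k)) \<le> discount_tail \<gamma> t"
    unfolding discount_tail_def
    using s s1 t pos x by (intro suminf_le) (auto simp: mult_left_le less_imp_le)
  moreover have "(\<Sum>k. \<gamma> (t + k) * ?x (t + k)) \<ge> 0"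
    using s t pos x by (intro suminf_nonneg) (auto simp: less_imp_le)
  ultimately show ?thesis
    using policy_value_eq[of rew \<gamma> t h \<mu> \<pi>, OF rew \<gamma> t_def] discount_tail_pos[OF \<gamma> t] by auto
qed

text \<open>A supremum of reals is an upper bound only for a bounded family; the bound is the value
  1, which no policy exceeds.\<close>

lemma policy_value_le_optimal_value:
  fixes \<pi> :: "('a::finite, 'e::finite) policy"
  assumes "\<And>e. 0 \<le> rew e \<and> rew e \<le> 1" "summable \<gamma>" "\<And>t. t \<ge> 1 \<Longrightarrow> \<gamma> t > 0"
  shows "policy_value \<gamma> rew \<mu> \<pi> h \<le> optimal_value \<gamma> rew \<mu> h"
proof -
  have "policy_value \<gamma> rew \<mu> \<pi>' h \<le> 1" for \<pi>'
    using policy_value_between[of rew \<gamma> \<mu> \<pi>' h] assms by simp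
  then show ?thesis
    unfolding optimal_value_def by (intro cSUP_upper) (auto intro!: bdd_aboveI2)
qed

lemma optimal_value_between:
  fixes \<mu> :: "('a::finite, 'e::finite) environment"
  assumes "\<And>e. 0 \<le> rew e \<and> rew e \<le> 1" "summable \<gamma>" "\<And>t. t \<ge> 1 \<Longrightarrow> \<gamma> t > 0"
  shows "optimal_value \<gamma> rew \<mu> h \<in> {0..1}"
proof -
  have "0 \<le> policy_value \<gamma> rew \<mu> \<pi> h" "policy_value \<gamma> rew \<mu> \<pi> h \<le> 1" for \<pi>
    using policy_value_between[of rew \<gamma> \<mu> \<pi> h] assms by auto
  moreover from this have "optimal_value \<gamma> rew \<mu> h \<le> 1"
    unfolding optimal_value_def by (intro cSUP_least) auto
  ultimately show ?thesis
    using policy_value_le_optimal_value[of rew \<gamma> \<mu> _ h] assms by (auto intro: order_trans)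
qed

text \<open>Along its own histories, a policy's conditional expected rewards average out to
  unconditional ones by the tower property. Expected values thereby become discounted tails of a
  single sequence of numbers.\<close>

lemma expectation_policy_value:
  fixes \<pi> :: "('a::finite, 'e::finite) policy"
  assumes rew: "\<And>e. 0 \<le> rew e \<and> rew e \<le> 1"
    and \<gamma>: "summable \<gamma>" "\<And>t. t \<ge> 1 \<Longrightarrow> \<gamma> t > 0" and t: "t \<ge> 1"
  shows "expectation \<mu> \<pi> (\<lambda>\<omega>. policy_value \<gamma> rew \<mu> \<pi> (hist_before t \<omega>)) =
    (\<Sum>k. \<gamma> (t + k) * expectation \<mu> \<pi> (reward rew (t + k))) / discount_tail \<gamma> t"
proof -
  let ?x = "\<lambda>s h. \<integral>\<omega>. reward rew s \<omega> \<partial>traj_measure \<pi> \<mu> h"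
  have pos: "\<gamma> (t + k) > 0" for k
    using \<gamma>(2) t by simp
  have s1: "summable (\<lambda>k. \<gamma> (t + k))"
    using summable_discounted[OF \<gamma>, of "\<lambda>_. 1" t] t by simp
  have x: "0 \<le> ?x s h" "?x s h \<le> 1" if "s \<ge> 1" for s h
    using integral_reward_between[of rew s \<pi> \<mu> h, OF rew that] by auto
  \<comment> \<open>All terms are nonnegative, so the norms in \<open>integral_suminf\<close>
    disappear and \<open>tower\<close> also evaluates the series of integrated norms.\<close>
  have abs: "\<bar>\<gamma> (t + k) * ?x (t + k) h\<bar> = \<gamma> (t + k) * ?x (t + k) h" for k h
    using x[of "t + k" h] pos[of k] t by (simp add: abs_mult)
  have tower: "(\<integral>\<omega>. ?x (t + k) (hist_before t \<omega>) \<partial>traj_measure \<pi> \<mu> []) =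
      expectation \<mu> \<pi> (reward rew (t + k))" for k
    using integral_reward_tower[OF t, of "t + k" \<mu> \<pi> rew] by (simp add: expectation_def)
  have len: "t = Suc (length (hist_before t \<omega>))" for \<omega> :: "nat \<Rightarrow> 'a \<times> 'e"
    using t by (simp add: hist_before_def)
  have "expectation \<mu> \<pi> (\<lambda>\<omega>. policy_value \<gamma> rew \<mu> \<pi> (hist_before t \<omega>)) =
      (\<integral>\<omega>. (\<Sum>k. \<gamma> (t + k) * ?x (t + k) (hist_before t \<omega>)) \<partial>traj_measure \<pi> \<mu> []) /
      discount_tail \<gamma> t"
    unfolding expectation_def by (subst policy_value_eq[of rew \<gamma>, OF rew \<gamma> len]) simp_all
  also have "(\<integral>\<omega>. (\<Sum>k. \<gamma> (t + k) * ?x (t + k) (hist_before t \<omega>)) \<partial>traj_measure \<pi> \<mu> []) =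
      (\<Sum>k. \<integral>\<omega>. \<gamma> (t + k) * ?x (t + k) (hist_before t \<omega>) \<partial>traj_measure \<pi> \<mu> [])"
  proof (rule integral_suminf)
    show "integrable (traj_measure \<pi> \<mu> []) (\<lambda>\<omega>. \<gamma> (t + k) * ?x (t + k) (hist_before t \<omega>))" for k
      by (rule integrable_hist_before[where f = "\<lambda>h. \<gamma> (t + k) * ?x (t + k) h"])
    show "AE \<omega> in traj_measure \<pi> \<mu> [].
        summable (\<lambda>k. norm (\<gamma> (t + k) * ?x (t + k) (hist_before t \<omega>)))"
      unfolding real_norm_def abs
      by (intro AE_I2 summable_discounted \<gamma> t) (use x in auto)
    show "summable (\<lambda>k. \<integral>\<omega>. norm (\<gamma> (t + k) * ?x (t + k) (hist_before t \<omega>))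
        \<partial>traj_measure \<pi> \<mu> [])"
      unfolding real_norm_def abs integral_mult_right_zero tower
      by (rule summable_discounted[OF \<gamma> _ t]) (use x in \<open>auto simp: expectation_def\<close>)
  qed
  finally show ?thesis
    by (simp add: tower)
qed

section \<open>Summation by parts and the effective horizon\<close>

lemma suminf_discounted_split:
  fixes \<gamma> x :: "nat \<Rightarrow> real"
  assumes "summable \<gamma>" "\<And>t. t \<ge> 1 \<Longrightarrow> \<gamma> t > 0" "\<And>t. t \<ge> 1 \<Longrightarrow> \<bar>x t\<bar> \<le> 1" "t \<ge> 1"
  shows "(\<Sum>k. \<gamma> (t + k) * x (t + k)) = \<gamma> t * x t + (\<Sum>k. \<gamma> (Suc t + k) * x (Suc t + k))"
  using suminf_split_head[of "\<lambda>k. \<gamma> (t + k) * x (t + k)"] summable_discounted[of \<gamma> x t] assms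
  by simp

text \<open>Consecutive tails differ by \<open>\<gamma> t * x t\<close>, and multiplying by
  \<open>a t = 1 / \<gamma> t\<close> recovers \<open>x t\<close>. With \<open>a 0 = 0\<close> there
  is no boundary term at the lower end.\<close>

lemma discounted_summation_by_parts:
  fixes \<gamma> x :: "nat \<Rightarrow> real"
  assumes \<gamma>: "summable \<gamma>" "\<And>t. t \<ge> 1 \<Longrightarrow> \<gamma> t > 0" and x: "\<And>t. t \<ge> 1 \<Longrightarrow> \<bar>x t\<bar> \<le> 1"
    and a: "a 0 = 0" "\<And>t. t \<ge> 1 \<Longrightarrow> a t = 1 / \<gamma> t"
  shows "(\<Sum>t=1..m. (a t - a (t - 1)) * (\<Sum>k. \<gamma> (t + k) * x (t + k))) =
    (\<Sum>t=1..m. x t) + a m * (\<Sum>k. \<gamma> (Suc m + k) * x (Suc m + k))"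
proof (induction m)
  case 0
  then show ?case by (simp add: a)
next
  case (Suc m)
  let ?D = "\<lambda>t. \<Sum>k. \<gamma> (t + k) * x (t + k)"
  have "(\<Sum>t=1..Suc m. (a t - a (t - 1)) * ?D t) = (\<Sum>t=1..m. x t) + a (Suc m) * ?D (Suc m)"
    using Suc.IH by (simp add: algebra_simps)
  also have "?D (Suc m) = \<gamma> (Suc m) * x (Suc m) + ?D (Suc (Suc m))"
    by (rule suminf_discounted_split) (use assms in auto)
  also have "a (Suc m) * \<dots> = x (Suc m) + a (Suc m) * ?D (Suc (Suc m))"
    using \<gamma>(2)[of "Suc m"] by (simp add: a(2) distrib_left)
  finally show ?case
    by (simp add: add.assoc)
qed

lemma discount_tail_split:
  assumes "summable \<gamma>"
  shows "discount_tail \<gamma> t = (\<Sum>i<k. \<gamma> (t + i)) + discount_tail \<gamma> (t + k)"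
proof -
  have "summable (\<lambda>k. \<gamma> (t + k))"
    using assms by (simp add: summable_iff_shift add.commute[of t])
  from suminf_split_initial_segment[OF this, of k] show ?thesis
    by (simp add: discount_tail_def ac_simps)
qed

text \<open>\<open>LEAST\<close> is meaningful only if some \<open>k\<close> qualifies; one does
  because the tails of a convergent series tend to 0.\<close>

lemma effective_horizon_attained:
  assumes "summable \<gamma>" "discount_tail \<gamma> t > 0" "\<epsilon> > 0"
  shows "discount_tail \<gamma> (t + effective_horizon \<gamma> t \<epsilon>) / discount_tail \<gamma> t \<le> \<epsilon>"
proof -
  have eq: "discount_tail \<gamma> (t + k) / discount_tail \<gamma> t = (\<Sum>i. \<gamma> (i + (k + t))) / discount_tail \<gamma> t" for k
    by (simp add: discount_tail_def ac_simps)
  have "(\<lambda>k. discount_tail \<gamma> (t + k) / discount_tail \<gamma> t) \<longlonglongrightarrow> 0 / discount_tail \<gamma> t"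
    unfolding eq
    by (intro tendsto_divide LIMSEQ_ignore_initial_segment[OF suminf_exist_split2[OF assms(1)], of t])
       (use assms(2) in auto)
  then have "eventually (\<lambda>k. discount_tail \<gamma> (t + k) / discount_tail \<gamma> t < \<epsilon>) sequentially"
    using assms(3) by (intro order_tendstoD) auto
  then have "\<exists>k. discount_tail \<gamma> (t + k) / discount_tail \<gamma> t \<le> \<epsilon>"
    by (meson eventually_sequentially less_imp_le order_refl)
  then show ?thesis
    unfolding effective_horizon_def by (rule LeastI_ex)
qed

text \<open>At least half of the tail from \<open>t\<close> lies in its first \<open>H\<close>
  terms, each at most \<open>\<gamma> t\<close> by monotonicity. Moving the other half to the left
  side gives the factor 2.\<close>

lemma discount_tail_le_effective_horizon:
  assumes \<gamma>: "summable \<gamma>" "\<And>t. t \<ge> 1 \<Longrightarrow> \<gamma> t > 0" and anti: "antimono_on {1..} \<gamma>" and t: "t \<ge> 1"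
  shows "discount_tail \<gamma> t / \<gamma> t \<le> 2 * real (effective_horizon \<gamma> t (1/2))"
proof -
  define H where "H = effective_horizon \<gamma> t (1/2)"
  have G: "discount_tail \<gamma> t > 0"
    by (rule discount_tail_pos[OF \<gamma> t])
  have half: "discount_tail \<gamma> (t + H) \<le> discount_tail \<gamma> t / 2"
    using effective_horizon_attained[OF \<gamma>(1) G, of "1/2"] G by (simp add: H_def field_simps)
  have "(\<Sum>i<H. \<gamma> (t + i)) \<le> (\<Sum>i<H. \<gamma> t)"
    using anti t by (intro sum_mono) (auto simp: monotone_on_def)
  with half discount_tail_split[OF \<gamma>(1), of t H] have "discount_tail \<gamma> t \<le> 2 * (real H * \<gamma> t)"
    by simp
  then show ?thesis
    using \<gamma>(2)[OF t] by (simp add: H_def field_simps)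
qed

text \<open>The quantifier over \<open>x\<close> stands inside the eventuality: the threshold for
  \<open>m\<close> depends on \<open>e\<close> and \<open>c\<close> but not on \<open>x\<close>.
  This uniformity is what a supremum over all policies at each \<open>m\<close> calls for.\<close>

lemma sum_le_of_discounted_tails:
  fixes \<gamma> :: "nat \<Rightarrow> real" and e :: "nat \<Rightarrow> real"
  assumes \<gamma>: "summable \<gamma>" "\<And>t. t \<ge> 1 \<Longrightarrow> \<gamma> t > 0" and anti: "antimono_on {1..} \<gamma>"
    and horizon: "(\<lambda>t. real (effective_horizon \<gamma> t (1/2))) \<in> o(\<lambda>t. real t)"
    and e: "e \<longlonglongrightarrow> 0" and c: "c > 0"
  shows "\<forall>\<^sub>F m in sequentially. \<forall>x. (\<forall>t\<ge>1. \<bar>x t\<bar> \<le> 1) \<longrightarrow>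
    (\<forall>t\<ge>1. (\<Sum>k. \<gamma> (t + k) * x (t + k)) \<le> e t * discount_tail \<gamma> t) \<longrightarrow>
    (\<Sum>t=1..m. x t) \<le> c * real m"
proof -
  \<comment> \<open>The value at 0 is set by hand, since \<open>\<gamma> 0\<close> is unconstrained;
    it makes the first increment \<open>1 / \<gamma> 1\<close>. Then \<open>b t\<close> is the
    weight with which \<open>e t\<close> enters, and \<open>q m\<close> bounds the boundary
    term.\<close>
  define a where "a t = (if t = 0 then 0 else 1 / \<gamma> t)" for t
  define b where "b t = (a t - a (t - 1)) * discount_tail \<gamma> t" for t
  define q where "q m = a m * discount_tail \<gamma> (Suc m)" for m
  have Gpos: "discount_tail \<gamma> t > 0" if "t \<ge> 1" for t
    by (rule discount_tail_pos[OF \<gamma> that])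
  have a: "a 0 = 0" "\<And>t. t \<ge> 1 \<Longrightarrow> a t = 1 / \<gamma> t"
    by (auto simp: a_def)
  have anonneg: "a m \<ge> 0" for m
    using \<gamma>(2)[of m] by (auto simp: a_def)
  have amono: "a (t - 1) \<le> a t" if "t \<ge> 1" for t
  proof (cases "t = 1")
    case True
    then show ?thesis using anonneg[of 1] by (simp add: a_def)
  next
    case False
    then have "\<gamma> t \<le> \<gamma> (t - 1)" "\<gamma> t > 0" "t - 1 \<ge> 1" "t \<ge> 1"
      using anti \<gamma>(2)[of t] that by (auto simp: monotone_on_def)
    then show ?thesis
      by (simp add: a(2) frac_le)
  qed
  have b: "b t \<ge> 0" if "t \<ge> 1" for t
    using amono[OF that] Gpos[OF that] by (simp add: b_def)
  \<comment> \<open>Summation by parts for the constant sequence 1 computes the total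
    weight.\<close>
  have sum_b: "(\<Sum>t=1..m. b t) = real m + q m" for m
    using discounted_summation_by_parts[OF \<gamma>, where x = "\<lambda>_. 1" and a = a and m = m] a
    by (simp add: b_def q_def discount_tail_def)
  have q_nonneg: "q m \<ge> 0" for m
    using anonneg[of m] Gpos[of "Suc m"] by (simp add: q_def)
  \<comment> \<open>The final estimate has four contributions, \<open>\<delta> * m\<close>,
    \<open>\<delta> * q m\<close>, \<open>K\<close> and the boundary term, each at most
    \<open>\<delta> * m\<close>; hence the 4. The bound \<open>\<delta> \<le> 1\<close> serves the
    second of them.\<close>
  define \<delta> where "\<delta> = min 1 (c / 4)"
  have \<delta>: "\<delta> > 0" "\<delta> \<le> 1" "\<delta> \<le> c / 4"
    using c by (auto simp: \<delta>_def)
  \<comment> \<open>The \<open>\<delta> / 2\<close> compensates the factor 2 in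
    \<open>discount_tail_le_effective_horizon\<close>.\<close>
  have "\<forall>\<^sub>F m in sequentially. real (effective_horizon \<gamma> m (1/2)) \<le> \<delta> / 2 * real m"
    using landau_o.smallD[OF horizon, of "\<delta> / 2"] \<delta> by simp
  then have q: "\<forall>\<^sub>F m in sequentially. q m \<le> \<delta> * real m"
    using eventually_ge_at_top[of 1]
  proof eventually_elim
    case (elim m)
    have "q m \<le> discount_tail \<gamma> m / \<gamma> m"
      using discount_tail_split[OF \<gamma>(1), of m 1] \<gamma>(2)[of m] elim(2)
      by (simp add: q_def a(2) divide_right_mono)
    with discount_tail_le_effective_horizon[OF \<gamma> anti elim(2)] elim(1) show ?case
      by simp
  qed
  obtain N where N: "\<And>t. t \<ge> N \<Longrightarrow> e t < \<delta>"
    using order_tendstoD(2)[OF e \<delta>(1)] by (auto simp: eventually_sequentially)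
  \<comment> \<open>This is the contribution of the times at which \<open>e\<close> may not yet be
    small. It is independent of \<open>m\<close> and \<open>x\<close>, so it is eventually below any
    linear function of positive slope.\<close>
  define K where "K = (\<Sum>t=1..N. b t * \<bar>e t\<bar>)"
  have K: "\<forall>\<^sub>F m in sequentially. K \<le> \<delta> * real m"
    using \<delta>(1) by real_asymp
  show ?thesis
    using q K
  proof (eventually_elim, intro allI impI)
    fix m and x :: "nat \<Rightarrow> real"
    assume qm: "q m \<le> \<delta> * real m" and Km: "K \<le> \<delta> * real m"
      and x: "\<forall>t\<ge>1. \<bar>x t\<bar> \<le> 1"
      and D: "\<forall>t\<ge>1. (\<Sum>k. \<gamma> (t + k) * x (t + k)) \<le> e t * discount_tail \<gamma> t"
    let ?D = "\<lambda>t. \<Sum>k. \<gamma> (t + k) * x (t + k)"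
    \<comment> \<open>The boundary term may be negative; \<open>x \<ge> -1\<close> keeps it above
      \<open>- q m\<close>.\<close>
    have "- ?D (Suc m) \<le> discount_tail \<gamma> (Suc m)"
    proof -
      have s: "summable (\<lambda>k. \<gamma> (Suc m + k) * x (Suc m + k))"
        by (rule summable_discounted) (use \<gamma> x in auto)
      have s1: "summable (\<lambda>k. \<gamma> (Suc m + k))"
        using summable_discounted[OF \<gamma>, of "\<lambda>_. 1" "Suc m"] by simp
      have "- (\<gamma> (Suc m + k) * x (Suc m + k)) \<le> \<gamma> (Suc m + k)" for k
      proof -
        have "- x (Suc m + k) \<le> 1"
          using x[rule_format, of "Suc m + k"] by simp
        then show ?thesis
          using mult_left_mono[of "- x (Suc m + k)" 1 "\<gamma> (Suc m + k)"] \<gamma>(2)[of "Suc m + k"]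
          by simp
      qed
      then show ?thesis
        using suminf_le[OF _ summable_minus[OF s] s1] suminf_minus[OF s]
        by (simp add: discount_tail_def)
    qed
    then have "- (a m * ?D (Suc m)) \<le> q m"
      using mult_left_mono[OF _ anonneg[of m]] by (fastforce simp: q_def)
    moreover have "(\<Sum>t=1..m. x t) + a m * ?D (Suc m) = (\<Sum>t=1..m. (a t - a (t - 1)) * ?D t)"
      by (rule discounted_summation_by_parts[symmetric]) (use \<gamma> x a in auto)
    moreover have "(\<Sum>t=1..m. (a t - a (t - 1)) * ?D t) \<le> (\<Sum>t=1..m. b t * e t)"
    proof (rule sum_mono)
      fix t assume "t \<in> {1..m}"
      then show "(a t - a (t - 1)) * ?D t \<le> b t * e t"
        using mult_left_mono[of "?D t" "e t * discount_tail \<gamma> t" "a t - a (t - 1)"] D amono[of t]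
        by (simp add: b_def mult_ac)
    qed
    \<comment> \<open>Every \<open>t\<close> receives \<open>\<delta> * b t\<close>, so that
      \<open>sum_b\<close> applies to the full range; the times up to \<open>N\<close> receive their
      actual size in addition.\<close>
    moreover have "(\<Sum>t=1..m. b t * e t) \<le>
        (\<Sum>t=1..m. \<delta> * b t + (if t \<le> N then b t * \<bar>e t\<bar> else 0))"
    proof (rule sum_mono)
      fix t assume "t \<in> {1..m}"
      then have bt: "b t \<ge> 0" using b by simp
      show "b t * e t \<le> \<delta> * b t + (if t \<le> N then b t * \<bar>e t\<bar> else 0)"
      proof (cases "t \<le> N")
        case True
        have "b t * e t \<le> b t * \<bar>e t\<bar>" "0 \<le> \<delta> * b t"
          using bt \<delta> by (auto intro: mult_left_mono)
        with True show ?thesis by simp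
      next
        case False
        then show ?thesis
          using mult_left_mono[OF less_imp_le[OF N[of t]] bt] by (simp add: mult.commute)
      qed
    qed
    moreover have "(\<Sum>t=1..m. \<delta> * b t + (if t \<le> N then b t * \<bar>e t\<bar> else 0)) \<le>
        \<delta> * (real m + q m) + K"
    proof -
      have "(\<Sum>t=1..m. if t \<le> N then b t * \<bar>e t\<bar> else 0) = (\<Sum>t\<in>{1..m} \<inter> {..N}. b t * \<bar>e t\<bar>)"
        by (subst sum.inter_restrict) auto
      also have "\<dots> \<le> K"
        unfolding K_def using b by (intro sum_mono2) auto
      finally show ?thesis
        by (simp only: sum.distrib sum_distrib_left[symmetric] sum_b)
    qed
    moreover have "\<delta> * (real m + q m) \<le> \<delta> * real m + \<delta> * real m"
      using mult_right_mono[OF \<delta>(2) q_nonneg[of m]] qm by (simp add: distrib_left)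
    ultimately have "(\<Sum>t=1..m. x t) \<le> 4 * \<delta> * real m"
      using qm Km by linarith
    also have "\<dots> \<le> c * real m"
      using \<delta>(3) by (intro mult_right_mono) auto
    finally show "(\<Sum>t=1..m. x t) \<le> c * real m" .
  qed
qed

section \<open>Sublinear regret\<close>

theorem theorem5p33:
  fixes \<gamma> :: "nat \<Rightarrow> real"
    and rew :: "'e::finite \<Rightarrow> real"
    and \<mu> :: "('a::finite, 'e) environment"
    and \<pi> \<pi>opt :: "('a, 'e) policy"
  assumes rew: "\<And>e. 0 \<le> rew e \<and> rew e \<le> 1"
    and discount: "discount_function \<gamma>"
    and pos: "\<And>t. t \<ge> 1 \<Longrightarrow> \<gamma> t > 0"
    and decreasing: "antimono_on {1..} \<gamma>"
    and horizon: "\<And>\<epsilon>. \<epsilon> > 0 \<Longrightarrow> (\<lambda>t. real (effective_horizon \<gamma> t \<epsilon>)) \<in> o(\<lambda>t. real t)"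
    and optimal: "optimal_policy \<gamma> rew \<mu> \<pi>opt"
    and recoverable: "recoverable \<gamma> rew \<mu> \<pi>opt"
    and asymptotically_optimal: "asymptotically_optimal_in_mean \<gamma> rew {\<mu>} \<pi>"
  shows "(\<lambda>m. regret rew \<pi> \<mu> m) \<in> o(\<lambda>m. real m)"
proof -
  have \<gamma>: "summable \<gamma>" "\<And>t. t \<ge> 1 \<Longrightarrow> \<gamma> t > 0"
    using discount pos by (auto simp: discount_function_def)
  let ?V = "\<lambda>\<pi>'' t. expectation \<mu> \<pi>'' (\<lambda>\<omega>. optimal_value \<gamma> rew \<mu> (hist_before t \<omega>))"
  let ?W = "\<lambda>\<pi>'' t. expectation \<mu> \<pi>'' (\<lambda>\<omega>. policy_value \<gamma> rew \<mu> \<pi>'' (hist_before t \<omega>))"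
  let ?r = "\<lambda>\<pi>'' t. expectation \<mu> \<pi>'' (reward rew t)"
  define S where "S t = (SUP \<pi>'. \<bar>?V \<pi>opt t - ?V \<pi>' t\<bar>)" for t
  define A where "A t = expectation \<mu> \<pi> (\<lambda>\<omega>. optimal_value \<gamma> rew \<mu> (hist_before t \<omega>) -
                                      policy_value \<gamma> rew \<mu> \<pi> (hist_before t \<omega>))" for t
  \<comment> \<open>Passing from the histories of \<open>\<pi>'\<close> to those of
    \<open>\<pi>opt\<close> and on to those of \<open>\<pi>\<close> costs \<open>S t\<close> twice;
    \<open>A t\<close> is the loss of \<open>\<pi>\<close> against the optimal value on its own
    histories.\<close>
  define e where "e t = 2 * S t + A t" for t
  have "S \<longlonglongrightarrow> 0" "A \<longlonglongrightarrow> 0"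
    using recoverable asymptotically_optimal
    by (simp_all add: S_def[abs_def] A_def[abs_def] recoverable_def asymptotically_optimal_in_mean_def)
  then have "(\<lambda>t. 2 * S t + A t) \<longlonglongrightarrow> 2 * 0 + 0"
    by (intro tendsto_intros)
  then have e: "e \<longlonglongrightarrow> 0"
    by (simp add: e_def[abs_def])
  have V: "?V \<pi>' t \<in> {0..1}" for \<pi>' t
    unfolding expectation_def
    by (rule integral_hist_before_between) (use optimal_value_between[of rew \<gamma> \<mu>, OF rew \<gamma>] in auto)
  have S: "\<bar>?V \<pi>opt t - ?V \<pi>' t\<bar> \<le> S t" for \<pi>' t
    unfolding S_def
  proof (rule cSUP_upper)
    have "\<bar>?V \<pi>opt t - ?V \<pi>'' t\<bar> \<le> 1" for \<pi>''
      using V[of \<pi>opt t] V[of \<pi>'' t] by auto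
    then show "bdd_above (range (\<lambda>\<pi>'. \<bar>?V \<pi>opt t - ?V \<pi>' t\<bar>))"
      by (intro bdd_aboveI2)
  qed simp
  have A: "A t = ?V \<pi> t - ?W \<pi> t" for t
    unfolding A_def expectation_def by (rule Bochner_Integration.integral_diff) auto
  have W_le_V: "?W \<pi>' t \<le> ?V \<pi>' t" for \<pi>' t
    unfolding expectation_def
    by (intro integral_mono integrable_hist_before policy_value_le_optimal_value[of rew \<gamma>, OF rew \<gamma>])
  have gap: "?W \<pi>' t - ?W \<pi> t \<le> e t" for \<pi>' t
    using S[of t \<pi>'] S[of t \<pi>] A[of t] W_le_V[of \<pi>' t] by (simp add: e_def)
  have r: "0 \<le> ?r \<pi>' t" "?r \<pi>' t \<le> 1" if "t \<ge> 1" for \<pi>' t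
    using integral_reward_between[of rew t \<pi>' \<mu> "[]", OF rew that] by (auto simp: expectation_def)
  have sum_r: "expectation \<mu> \<pi>' (\<lambda>\<omega>. \<Sum>t=1..m. reward rew t \<omega>) = (\<Sum>t=1..m. ?r \<pi>' t)" for \<pi>' m
    unfolding expectation_def by (rule Bochner_Integration.integral_sum) simp
  \<comment> \<open>Multiplying the gap in expected values by the normalising
    \<open>discount_tail \<gamma> t\<close> gives the hypothesis of
    \<open>sum_le_of_discounted_tails\<close> for the differences of expected rewards.\<close>
  have tails: "(\<Sum>k. \<gamma> (t + k) * (?r \<pi>' (t + k) - ?r \<pi> (t + k))) \<le> e t * discount_tail \<gamma> t"
    if t: "t \<ge> 1" for \<pi>' t
  proof -
    have s: "summable (\<lambda>k. \<gamma> (t + k) * ?r \<pi>'' (t + k))" for \<pi>''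
      by (rule summable_discounted) (use \<gamma> t r in auto)
    have W: "?W \<pi>'' t = (\<Sum>k. \<gamma> (t + k) * ?r \<pi>'' (t + k)) / discount_tail \<gamma> t" for \<pi>''
      by (rule expectation_policy_value[OF rew \<gamma> t])
    have "(\<Sum>k. \<gamma> (t + k) * (?r \<pi>' (t + k) - ?r \<pi> (t + k))) / discount_tail \<gamma> t = ?W \<pi>' t - ?W \<pi> t"
      by (simp add: W right_diff_distrib
          suminf_diff[OF s s, symmetric] diff_divide_distrib)
    with gap[of \<pi>' t] discount_tail_pos[OF \<gamma> t] show ?thesis
      by (simp add: divide_simps mult.commute split: if_splits)
  qed
  show ?thesis
  proof (rule landau_o.smallI)
    fix c :: real
    assume "c > 0"
    have "\<forall>\<^sub>F m in sequentially. \<forall>x. (\<forall>t\<ge>1. \<bar>x t\<bar> \<le> 1) \<longrightarrow>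
        (\<forall>t\<ge>1. (\<Sum>k. \<gamma> (t + k) * x (t + k)) \<le> e t * discount_tail \<gamma> t) \<longrightarrow>
        (\<Sum>t=1..m. x t) \<le> c * real m"
      by (rule sum_le_of_discounted_tails) (use \<gamma> decreasing horizon e \<open>c > 0\<close> in auto)
    then show "\<forall>\<^sub>F m in sequentially. norm (regret rew \<pi> \<mu> m) \<le> c * norm (real m)"
    proof eventually_elim
      case (elim m)
      let ?R = "\<lambda>\<pi>'. \<Sum>t=1..m. ?r \<pi>' t"
      \<comment> \<open>The same \<open>m\<close> serves every \<open>\<pi>'\<close>, since
        \<open>elim\<close> holds for all sequences simultaneously.\<close>
      have diff: "?R \<pi>' - ?R \<pi> \<le> c * real m" for \<pi>'
        unfolding sum_subtractf[symmetric]
      proof (rule elim[rule_format])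
        show "\<bar>?r \<pi>' t - ?r \<pi> t\<bar> \<le> 1" if "t \<ge> 1" for t
          using r[OF that, of \<pi>'] r[OF that, of \<pi>] by auto
      qed (rule tails)
      have R: "?R \<pi>' \<le> ?R \<pi> + c * real m" for \<pi>'
        using diff[of \<pi>'] by simp
      have "(SUP \<pi>'. ?R \<pi>') \<le> ?R \<pi> + c * real m"
        by (rule cSUP_least) (use R in auto)
      \<comment> \<open>As \<open>\<pi>\<close> competes in the supremum, the regret is nonnegative
        and equals its norm.\<close>
      moreover have "?R \<pi> \<le> (SUP \<pi>'. ?R \<pi>')"
        by (rule cSUP_upper) (use bdd_aboveI2[OF R] in auto)
      ultimately show ?case
        unfolding regret_def sum_r by simp
    qed
  qed
qed

end
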